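(* Let $n\geq1$ and $0\leq k\leq n$ be integers. There is a function $\eta(q)=o(1)$ as $q\to\infty$ (depending only on $n,k,q$) such that for every prime power $q$, every nonempty set $E\subseteq\mathbb{F}_q^n$ and every real $u$ with $0<u\leq\frac{q^k}{2}$, $$|\{V\in G(k,n): |\pi_V(E)|\leq u\}|\leq(4+\eta(q))\,u\,q^{k(n-k)}|E|^{-1}.$$
   Context: $\mathbb{F}_q$ is the finite field with $q$ elements and $|X|$ is the cardinality of a finite set $X$. $G(k,n)$ is the set of all $k$-dimensional linear subspaces of $\mathbb{F}_q^n$. For a subspace $V$, $V^\perp=\{y\in\mathbb{F}_q^n: x\cdot y=0 \text{ for all } x\in V\}$, where $x\cdot y$ is the usual dot product. The projection of $E\subseteq\mathbb{F}_q^n$ onto $V$ is the set of cosets $$\pi_V(E)=\{x+V^\perp: x\in\mathbb{F}_q^n,\ (x+V^\perp)\cap E\neq\varnothing\}.$$ *)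

theory Defs
  imports
    "HOL-Library.Landau_Symbols"
    "HOL-Number_Theory.Prime_Powers"
    "HOL-Algebra.AbelCoset"
    "Jordan_Normal_Form.Missing_VectorSpace"
begin

text \<open>
  The field is a carrier-based structure \<open>R\<close> rather than a type of class \<open>field\<close>, because the
  error term in the theorem has to be chosen before the field, uniformly over fields of all
  cardinalities, and types cannot be quantified inside a formula. Every finite field has an isomorphic copy whose
  carrier is a set of natural numbers, so the type instance \<open>'a = nat\<close> already covers all of them
  with a single error term. The vectors of the coordinate
  space are the extensional functions \<open>{..<n} \<rightarrow>\<^sub>E carrier R\<close>.
\<close>

abbreviation coord_space :: "('a, 'm) ring_scheme \<Rightarrow> nat \<Rightarrow> ('a, nat \<Rightarrow> 'a) module" where
  "coord_space R n \<equiv> ring.func_space R {..<n}"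

definition grassmannian :: "('a, 'm) ring_scheme \<Rightarrow> nat \<Rightarrow> nat \<Rightarrow> (nat \<Rightarrow> 'a) set set" where
  "grassmannian R k n =
    {V. subspace R V (coord_space R n) \<and>
        vectorspace.dim R ((coord_space R n)\<lparr>carrier := V\<rparr>) = k}"

definition dot_prod :: "('a, 'm) ring_scheme \<Rightarrow> nat \<Rightarrow> (nat \<Rightarrow> 'a) \<Rightarrow> (nat \<Rightarrow> 'a) \<Rightarrow> 'a" where
  "dot_prod R n x y = (\<Oplus>\<^bsub>R\<^esub>i\<in>{..<n}. x i \<otimes>\<^bsub>R\<^esub> y i)"

definition orth_compl :: "('a, 'm) ring_scheme \<Rightarrow> nat \<Rightarrow> (nat \<Rightarrow> 'a) set \<Rightarrow> (nat \<Rightarrow> 'a) set" where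
  "orth_compl R n V =
    {y \<in> carrier (coord_space R n). \<forall>x\<in>V. dot_prod R n x y = \<zero>\<^bsub>R\<^esub>}"

definition projection ::
  "('a, 'm) ring_scheme \<Rightarrow> nat \<Rightarrow> (nat \<Rightarrow> 'a) set \<Rightarrow> (nat \<Rightarrow> 'a) set \<Rightarrow> (nat \<Rightarrow> 'a) set set" where
  "projection R n V E =
    {x <+\<^bsub>coord_space R n\<^esub> orth_compl R n V | x.
      x \<in> carrier (coord_space R n) \<and>
      (x <+\<^bsub>coord_space R n\<^esub> orth_compl R n V) \<inter> E \<noteq> {}}"

end

theory Submission
  imports "HOL-Analysis.Convex" Defs
begin

text \<open>
  Instead of subspaces one counts \<open>k\<close>-tuples \<open>m\<close> of vectors of \<open>F\<^sub>q\<^sup>n\<close>. The maps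
  \<open>L\<^sub>m : x \<mapsto> (m\<^sub>i \<bullet> x)\<^sub>i\<close> form a universal hash family: two distinct points collide under
  a fraction \<open>q\<^sup>-\<^sup>k\<close> of them. A map with at most \<open>u \<le> q\<^sup>k / 2\<close> values on \<open>E\<close> has, by
  Cauchy-Schwarz, at least \<open>|E|\<^sup>2 / (2u)\<close> collisions more than the lower bound \<open>|E|\<^sup>2 / q\<^sup>k\<close> valid
  for all maps; since the total excess is at most \<open>|E| q\<^sup>n\<^sup>k\<close>, there are at most
  \<open>2 u q\<^sup>n\<^sup>k / |E|\<close> such tuples. If \<open>m\<close> spans \<open>V\<close>, then \<open>L\<^sub>m\<close> factors through the projection
  onto \<open>V\<close>, so all tuples spanning a bad \<open>V\<close> are of this kind, and for \<open>q \<ge> 2k\<close> at least half of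
  the \<open>q\<^sup>k\<^sup>k\<close> tuples in \<open>V\<close> span it. Hence \<open>\<eta> q = 0\<close> for \<open>q \<ge> 2k\<close>; for smaller \<open>q\<close> one spanning
  tuple per subspace suffices.
\<close>

section \<open>Second moments of hash families\<close>

text \<open>Cauchy-Schwarz for the fibre sizes \<open>c t\<close>: they sum to
  \<open>card E\<close>, and their squares sum to the number of ordered colliding pairs, diagonal
  included.\<close>

lemma card_sq_le_card_image_mult_collisions:
  fixes f :: "'x \<Rightarrow> 't"
  assumes "finite E"
  shows "real (card E) ^ 2 \<le> real (card (f ` E)) * real (card {p \<in> E \<times> E. f (fst p) = f (snd p)})"
proof -
  define c where "c t = card {x \<in> E. f x = t}" for t
  have E: "card E = (\<Sum>t\<in>f ` E. c t)"
    unfolding c_def using sum.image_gen[OF assms, of "\<lambda>_. 1 :: nat" f] by simp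
  have eq: "{p \<in> E \<times> E. f (fst p) = f (snd p)} =
      (\<Union>t\<in>f ` E. {x \<in> E. f x = t} \<times> {x \<in> E. f x = t})"
    by auto
  have "card {p \<in> E \<times> E. f (fst p) = f (snd p)} = (\<Sum>t\<in>f ` E. c t ^ 2)"
    unfolding eq using assms
    by (subst card_UN_disjoint) (auto simp: card_cartesian_product c_def power2_eq_square)
  moreover have "(\<Sum>t\<in>f ` E. real (c t)) ^ 2 \<le> real (card (f ` E)) * (\<Sum>t\<in>f ` E. real (c t) ^ 2)"
    using Cauchy_Schwarz_ineq_sum[of "\<lambda>_. 1" "\<lambda>t. real (c t)" "f ` E"] by simp
  ultimately show ?thesis
    unfolding E by (simp only: of_nat_sum of_nat_power)
qed

text \<open>Double counting of the triples formed by a map and an ordered pair colliding under it.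
  Summed by maps and by pairs, both sides contain \<open>card M * (e\<^sup>2 / N)\<close>, which
  cancels and leaves the excess of the bad maps against the diagonal.\<close>

lemma universal_family_few_values_le:
  fixes L :: "'m \<Rightarrow> 'x \<Rightarrow> 't" and u :: real
  assumes finM: "finite M" and finE: "finite E" and E: "E \<noteq> {}" and finT: "finite T"
    and T: "\<And>m x. m \<in> M \<Longrightarrow> x \<in> E \<Longrightarrow> L m x \<in> T"
    and collisions: "\<And>x y. x \<in> E \<Longrightarrow> y \<in> E \<Longrightarrow> x \<noteq> y \<Longrightarrow>
      card {m \<in> M. L m x = L m y} * card T \<le> card M"
    and u: "0 < u" "u \<le> real (card T) / 2"
  shows "real (card {m \<in> M. real (card (L m ` E)) \<le> u}) * real (card E) \<le> 2 * u * real (card M)"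
proof -
  define B where "B = {m \<in> M. real (card (L m ` E)) \<le> u}"
  define N where "N = real (card T)"
  define e where "e = real (card E)"
  define P where "P m = real (card {p \<in> E \<times> E. L m (fst p) = L m (snd p)})" for m
  have N: "0 < N" "u \<le> N / 2" and e: "0 < e"
    using u finE E by (auto simp: N_def e_def intro: Nat.gr0I)
  have BM: "B \<subseteq> M" and finB: "finite B"
    using finM by (auto simp: B_def)
  have CS: "e\<^sup>2 \<le> real (card (L m ` E)) * P m" for m
    unfolding e_def P_def by (rule card_sq_le_card_image_mult_collisions[OF finE])
  have P0: "0 \<le> P m" for m by (simp add: P_def)
  have all: "e\<^sup>2 / N \<le> P m" if "m \<in> M" for m
  proof -
    have "card (L m ` E) \<le> card T"
      using that T finT by (intro card_mono) auto
    then have "e\<^sup>2 \<le> N * P m"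
      using order_trans[OF CS mult_right_mono[OF _ P0]] by (simp add: N_def)
    then show ?thesis using N by (simp add: field_simps)
  qed
  \<comment> \<open>Of the Cauchy-Schwarz bound \<open>e\<^sup>2 / u\<close>, one half dominates the
    general bound \<open>e\<^sup>2 / N\<close> because \<open>2 * u \<le> N\<close>; the other half
    is the excess.\<close>
  have bad: "e\<^sup>2 / N + e\<^sup>2 / (2 * u) \<le> P m" if "m \<in> B" for m
  proof -
    have "e\<^sup>2 \<le> u * P m"
      using that order_trans[OF CS mult_right_mono[OF _ P0]] by (simp add: B_def)
    then have "e\<^sup>2 / u \<le> P m" using u by (simp add: field_simps)
    moreover have "e\<^sup>2 / N \<le> e\<^sup>2 / (2 * u)"
      using u N by (intro divide_left_mono) auto
    moreover have "e\<^sup>2 / u = e\<^sup>2 / (2 * u) + e\<^sup>2 / (2 * u)" by simp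
    ultimately show ?thesis by linarith
  qed
  have "card M * (e\<^sup>2 / N) + card B * (e\<^sup>2 / (2 * u)) =
      (\<Sum>m\<in>M. e\<^sup>2 / N + (if m \<in> B then e\<^sup>2 / (2 * u) else 0))"
    using finM BM by (simp add: sum.distrib sum.If_cases Int_absorb1)
  also have "\<dots> \<le> (\<Sum>m\<in>M. P m)"
    using all bad by (intro sum_mono) auto
  also have "\<dots> = (\<Sum>p\<in>E \<times> E. real (card {m \<in> M. L m (fst p) = L m (snd p)}))"
  proof -
    have fE: "finite (E \<times> E)" using finE by simp
    have "(\<Sum>m\<in>M. P m) = (\<Sum>m\<in>M. \<Sum>p\<in>E \<times> E. if L m (fst p) = L m (snd p) then 1 else 0)"
      unfolding P_def using fE by (simp add: sum.If_cases Int_def)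
    also have "\<dots> = (\<Sum>p\<in>E \<times> E. \<Sum>m\<in>M. if L m (fst p) = L m (snd p) then 1 else 0)"
      by (rule sum.swap)
    finally show ?thesis using finM by (simp add: sum.If_cases Int_def)
  qed
  \<comment> \<open>Adding \<open>card M / N\<close> on the diagonal too makes this term uniform
    over all pairs, so that its sum matches the lower bound exactly.\<close>
  also have "\<dots> \<le> (\<Sum>p\<in>E \<times> E. (if fst p = snd p then real (card M) else 0) + real (card M) / N)"
  proof (rule sum_mono)
    fix p assume p: "p \<in> E \<times> E"
    show "real (card {m \<in> M. L m (fst p) = L m (snd p)}) \<le>
        (if fst p = snd p then real (card M) else 0) + real (card M) / N"
    proof (cases "fst p = snd p")
      case True
      then show ?thesis using N by simp
    next
      case False
      then have "card {m \<in> M. L m (fst p) = L m (snd p)} * card T \<le> card M"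
        using p by (intro collisions) auto
      then have "real (card {m \<in> M. L m (fst p) = L m (snd p)}) * N \<le> card M"
        unfolding N_def by (metis of_nat_le_iff of_nat_mult)
      then show ?thesis using False N by (simp add: field_simps)
    qed
  qed
  also have "\<dots> = e * card M + card M * (e\<^sup>2 / N)"
  proof -
    have "(E \<times> E) \<inter> {p. fst p = snd p} = (\<lambda>x. (x, x)) ` E" by auto
    then have "card ((E \<times> E) \<inter> {p. fst p = snd p}) = card E"
      by (simp add: card_image inj_on_def)
    then show ?thesis
      using finE by (simp add: sum.distrib sum.If_cases card_cartesian_product e_def power2_eq_square)
  qed
  finally have "card B * (e\<^sup>2 / (2 * u)) \<le> e * card M" by simp
  then have "card B * e\<^sup>2 \<le> e * card M * (2 * u)"
    using u by (simp add: field_simps)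
  then have "e * (card B * e) \<le> e * (2 * u * card M)"
    by (simp add: power2_eq_square mult_ac)
  then show ?thesis
    using e by (simp add: B_def e_def)
qed

section \<open>Generating tuples of a finite vector space\<close>

context vectorspace
begin

lemma fin_dimI: "finite (carrier V) \<Longrightarrow> fin_dim"
  unfolding fin_dim_def using span_is_subset2[of "carrier V"] in_own_span[of "carrier V"] by blast

lemma card_span_le:
  assumes "finite (carrier K)" "finite A" "A \<subseteq> carrier V"
  shows "card (span A) \<le> card (carrier K) ^ card A"
proof -
  have "span A \<subseteq> (\<lambda>a. lincomb a A) ` (A \<rightarrow>\<^sub>E carrier K)"
  proof
    fix v assume "v \<in> span A"
    then obtain a where a: "a \<in> A \<rightarrow> carrier K" "v = lincomb a A"
      using finite_span[OF assms(2,3)] by auto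
    \<comment> \<open>Coefficient functions are arbitrary outside \<open>A\<close>; restricting them
      leaves the finite set \<open>A \<rightarrow>\<^sub>E carrier K\<close> to count.\<close>
    have "lincomb a A = lincomb (restrict a A) A"
      using a assms(3) by (intro lincomb_cong) auto
    then show "v \<in> (\<lambda>a. lincomb a A) ` (A \<rightarrow>\<^sub>E carrier K)"
      using a by (intro image_eqI[of _ _ "restrict a A"]) auto
  qed
  then have "card (span A) \<le> card (A \<rightarrow>\<^sub>E carrier K)"
    using assms by (intro surj_card_le) (auto simp: finite_PiE)
  then show ?thesis
    using assms by (simp add: card_funcsetE)
qed

lemma card_carrier:
  assumes "finite (carrier V)"
  shows "card (carrier V) = card (carrier K) ^ dim"
proof -
  have fin_dim by (rule fin_dimI[OF assms])
  then obtain b where b: "finite b" "basis b" using finite_basis_exists by blast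
  then have bV: "b \<subseteq> carrier V" by (simp add: basis_def)
  have crit: "\<forall>v. v \<in> carrier V \<longrightarrow> (\<exists>!a. a \<in> b \<rightarrow>\<^sub>E carrier K \<and> lincomb a b = v)"
    using basis_criterion[OF b(1) bV] b(2) by simp
  have "bij_betw (\<lambda>a. lincomb a b) (b \<rightarrow>\<^sub>E carrier K) (carrier V)"
    unfolding bij_betw_def
  proof
    have closed: "lincomb a b \<in> carrier V" if "a \<in> b \<rightarrow>\<^sub>E carrier K" for a
      using that bV by (intro lincomb_closed) auto
    show "inj_on (\<lambda>a. lincomb a b) (b \<rightarrow>\<^sub>E carrier K)"
      using crit closed unfolding inj_on_def by metis
    show "(\<lambda>a. lincomb a b) ` (b \<rightarrow>\<^sub>E carrier K) = carrier V"
      using crit closed by (auto simp: image_iff)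
  qed
  then have "card (carrier V) = card (b \<rightarrow>\<^sub>E carrier K)"
    by (simp add: bij_betw_same_card)
  then show ?thesis
    using b by (simp add: card_funcsetE dim_basis)
qed

text \<open>Any enumeration of a basis will do. This crude count serves small fields, where the
  lower bound for generating tuples can be vacuous.\<close>

lemma exists_generating_tuple:
  assumes "finite (carrier V)"
  shows "\<exists>m \<in> {..<dim} \<rightarrow>\<^sub>E carrier V. span (m ` {..<dim}) = carrier V"
proof -
  have fin_dim by (rule fin_dimI[OF assms])
  then obtain b where b: "finite b" "basis b" using finite_basis_exists by blast
  have "card b = dim" using dim_basis[OF b] by simp
  then obtain h where h: "bij_betw h {..<dim} b"
    using b by (metis ex_bij_betw_nat_finite atLeast0LessThan)
  have "restrict h {..<dim} ` {..<dim} = b"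
    using h by (simp add: bij_betw_def)
  then show ?thesis
    using b by (intro bexI[of _ "restrict h {..<dim}"]) (auto simp: basis_def)
qed

text \<open>If a \<open>dim\<close>-tuple does not generate, one of its entries lies in the span of the others, which
  has at most \<open>card (carrier K) ^ (dim - 1)\<close> elements.\<close>

lemma card_generating_tuples_ge:
  assumes finK: "finite (carrier K)" and finV: "finite (carrier V)"
  shows "card (carrier K) ^ (dim * dim) \<le>
    card {m \<in> {..<dim} \<rightarrow>\<^sub>E carrier V. span (m ` {..<dim}) = carrier V} +
    dim * card (carrier K) ^ (dim * dim - 1)"
proof -
  define I where "I = {..<dim}"
  define T where "T = I \<rightarrow>\<^sub>E carrier V"
  define G where "G = {m \<in> T. span (m ` I) = carrier V}"
  define D where "D i = {m \<in> T. m i \<in> span (m ` (I - {i}))}" for i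
  define q where "q = card (carrier K)"
  have finI: "finite I" and cardI: "card I = dim" by (auto simp: I_def)
  have finT: "finite T" unfolding T_def using finI finV by (auto simp: finite_PiE)
  have fd: fin_dim by (rule fin_dimI[OF finV])
  have cover: "T \<subseteq> G \<union> (\<Union>i\<in>I. D i)"
  proof
    fix m assume m: "m \<in> T"
    show "m \<in> G \<union> (\<Union>i\<in>I. D i)"
    proof (cases "m \<in> (\<Union>i\<in>I. D i)")
      case False
      have mV: "m ` I \<subseteq> carrier V" using m by (auto simp: T_def)
      have out: "m i \<notin> span (m ` (I - {i}))" if "i \<in> I" for i
        using False m that by (auto simp: D_def)
      have inj: "inj_on m I"
      proof (rule inj_onI, rule ccontr)
        fix i j assume ij: "i \<in> I" "j \<in> I" "m i = m j" "i \<noteq> j"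
        have "m ` (I - {i}) \<subseteq> span (m ` (I - {i}))" using mV by (intro in_own_span) auto
        then show False using ij out[of i] by auto
      qed
      have "\<not> lin_dep (m ` I)"
      proof
        assume "lin_dep (m ` I)"
        then obtain i where "i \<in> I" "m i \<in> span (m ` I - {m i})"
          using lindep_span[OF mV] finI by auto
        moreover from this inj have "m ` I - {m i} = m ` (I - {i})"
          by (auto simp: inj_on_def)
        ultimately show False using out by simp
      qed
      then have "basis (m ` I)"
        using fd mV finI inj by (intro dim_li_is_basis) (auto simp: card_image cardI)
      then show ?thesis using m by (simp add: G_def basis_def)
    qed simp
  qed
  have D: "card (D i) \<le> q ^ (dim * dim - 1)" if i: "i \<in> I" for i
  proof -
    define J where "J = I - {i}"
    have J: "finite J" "card J = dim - 1" using finI i cardI by (auto simp: J_def)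
    \<comment> \<open>The tuples in \<open>D i\<close> are encoded by their entries off
      \<open>i\<close> together with an \<open>i\<close>-th entry in the span of those, so
      \<open>S\<close> bounds their number.\<close>
    define S where "S = (SIGMA m:(J \<rightarrow>\<^sub>E carrier V). span (m ` J))"
    have sp: "card (span (m ` J)) \<le> q ^ (dim - 1)" "finite (span (m ` J))"
      if "m \<in> J \<rightarrow>\<^sub>E carrier V" for m
    proof -
      have mJ: "m ` J \<subseteq> carrier V" using that by auto
      have "card (span (m ` J)) \<le> q ^ card (m ` J)"
        unfolding q_def using finK J mJ by (intro card_span_le) auto
      also have "\<dots> \<le> q ^ (dim - 1)"
      proof (rule power_increasing)
        show "card (m ` J) \<le> dim - 1" using J card_image_le[of J m] by simp
        show "1 \<le> q" using finK by (auto simp: q_def Suc_le_eq card_gt_0_iff)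
      qed
      finally show "card (span (m ` J)) \<le> q ^ (dim - 1)" .
      show "finite (span (m ` J))"
        using span_is_subset2[OF mJ] finV finite_subset by blast
    qed
    have finS: "finite S" unfolding S_def using J finV sp by (auto simp: finite_PiE)
    have "D i \<subseteq> (\<lambda>(m, v). m(i := v)) ` S"
    proof
      fix m assume m: "m \<in> D i"
      have "restrict m J ` J = m ` J" by auto
      then have "(restrict m J, m i) \<in> S"
        using m i by (auto simp: S_def D_def T_def J_def)
      moreover have "m = (restrict m J)(i := m i)"
        using m by (auto simp: D_def T_def J_def fun_eq_iff PiE_def extensional_def)
      ultimately show "m \<in> (\<lambda>(m, v). m(i := v)) ` S"
        by (metis (no_types, lifting) case_prod_conv image_eqI)
    qed
    then have "card (D i) \<le> card S" using finS by (rule surj_card_le[rotated])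
    also have "\<dots> = (\<Sum>m\<in>J \<rightarrow>\<^sub>E carrier V. card (span (m ` J)))"
      unfolding S_def using J finV sp by (intro card_SigmaI) (auto simp: finite_PiE)
    also have "\<dots> \<le> (\<Sum>m\<in>J \<rightarrow>\<^sub>E carrier V. q ^ (dim - 1))"
      using sp by (intro sum_mono) auto
    also have "\<dots> = (q ^ dim) ^ (dim - 1) * q ^ (dim - 1)"
      using J card_carrier[OF finV] by (simp add: card_funcsetE q_def)
    also have "\<dots> = q ^ (dim * (dim - 1) + (dim - 1))"
      by (simp add: power_mult power_add)
    also have "dim * (dim - 1) + (dim - 1) = dim * dim - 1"
      using i by (cases dim) (auto simp: I_def)
    finally show ?thesis .
  qed
  have "q ^ (dim * dim) = card T"
    using finI card_carrier[OF finV] by (simp add: T_def card_funcsetE q_def cardI power_mult)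
  also have "\<dots> \<le> card (G \<union> (\<Union>i\<in>I. D i))"
    using cover finT finI by (intro card_mono) (auto simp: G_def D_def)
  also have "\<dots> \<le> card G + card (\<Union>i\<in>I. D i)" by (rule card_Un_le)
  also have "\<dots> \<le> card G + dim * q ^ (dim * dim - 1)"
  proof -
    have "card (\<Union>i\<in>I. D i) \<le> (\<Sum>i\<in>I. card (D i))" using finI by (rule card_UN_le)
    also have "\<dots> \<le> card I * q ^ (dim * dim - 1)" using D sum_bounded_above[of I "\<lambda>i. card (D i)"] by auto
    finally show ?thesis by (simp add: cardI)
  qed
  finally show ?thesis
    by (simp add: q_def G_def T_def I_def)
qed

end

section \<open>The coordinate space\<close>

context field
begin

lemma coord_space_simps [simp]:
  "carrier (coord_space R n) = {..<n} \<rightarrow>\<^sub>E carrier R"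
  "\<zero>\<^bsub>coord_space R n\<^esub> = restrict (\<lambda>_. \<zero>) {..<n}"
  "x \<oplus>\<^bsub>coord_space R n\<^esub> y = restrict (\<lambda>i. x i \<oplus> y i) {..<n}"
  by (simp_all add: func_space_def)

lemma vectorspace_coord_space: "vectorspace R (coord_space R n)"
  unfolding vectorspace_def
  using func_space_is_module[of "{..<n}"] field_axioms by auto

lemma zero_in_orth_compl:
  assumes "V \<subseteq> {..<n} \<rightarrow>\<^sub>E carrier R"
  shows "\<zero>\<^bsub>coord_space R n\<^esub> \<in> orth_compl R n V"
proof -
  have "dot_prod R n v (restrict (\<lambda>_. \<zero>) {..<n}) = \<zero>" if "v \<in> V" for v
  proof -
    have v: "v i \<in> carrier R" if "i < n" for i
      using PiE_mem[OF subsetD[OF assms \<open>v \<in> V\<close>]] that by simp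
    have "dot_prod R n v (restrict (\<lambda>_. \<zero>) {..<n}) = (\<Oplus>i\<in>{..<n}. \<zero>)"
      unfolding dot_prod_def by (rule finsum_cong') (simp_all add: v)
    then show ?thesis by simp
  qed
  then show ?thesis by (auto simp: orth_compl_def)
qed

lemma dot_prod_closed [simp]:
  assumes "x \<in> {..<n} \<rightarrow>\<^sub>E carrier R" "y \<in> {..<n} \<rightarrow>\<^sub>E carrier R"
  shows "dot_prod R n x y \<in> carrier R"
  unfolding dot_prod_def using PiE_mem[OF assms(1)] PiE_mem[OF assms(2)]
  by (intro finsum_closed Pi_I) simp

lemma dot_prod_add_right:
  assumes "x \<in> {..<n} \<rightarrow>\<^sub>E carrier R" "y \<in> {..<n} \<rightarrow>\<^sub>E carrier R" "z \<in> {..<n} \<rightarrow>\<^sub>E carrier R"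
  shows "dot_prod R n x (y \<oplus>\<^bsub>coord_space R n\<^esub> z) = dot_prod R n x y \<oplus> dot_prod R n x z"
proof -
  have cl: "x i \<in> carrier R" "y i \<in> carrier R" "z i \<in> carrier R" if "i < n" for i
    using that assms[THEN PiE_mem, of i] by simp_all
  have "dot_prod R n x (y \<oplus>\<^bsub>coord_space R n\<^esub> z) = (\<Oplus>i\<in>{..<n}. x i \<otimes> y i \<oplus> x i \<otimes> z i)"
    unfolding dot_prod_def by (rule finsum_cong') (simp_all add: cl r_distr)
  also have "\<dots> = dot_prod R n x y \<oplus> dot_prod R n x z"
    unfolding dot_prod_def by (rule finsum_addf) (simp_all add: cl)
  finally show ?thesis .
qed

text \<open>A vector with equal dot products against two points that differ in coordinate \<open>j\<close> is
  determined by its other coordinates.\<close>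

lemma card_dot_prod_collisions:
  assumes fin: "finite (carrier R)"
    and y: "y \<in> {..<n} \<rightarrow>\<^sub>E carrier R" and z: "z \<in> {..<n} \<rightarrow>\<^sub>E carrier R" and yz: "y \<noteq> z"
  shows "card {v \<in> {..<n} \<rightarrow>\<^sub>E carrier R. dot_prod R n v y = dot_prod R n v z} * card (carrier R)
    \<le> card (carrier R) ^ n"
proof -
  define H where "H = {v \<in> {..<n} \<rightarrow>\<^sub>E carrier R. dot_prod R n v y = dot_prod R n v z}"
  obtain j where j: "j < n" "y j \<noteq> z j"
    using y z yz by (metis PiE_ext lessThan_iff)
  define J where "J = {..<n} - {j}"
  have J: "finite J" "card J = n - 1" "insert j J = {..<n}" "j \<notin> J"
    using j by (auto simp: J_def)
  have split: "dot_prod R n v w = v j \<otimes> w j \<oplus> (\<Oplus>i\<in>J. v i \<otimes> w i)"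
    if "v \<in> {..<n} \<rightarrow>\<^sub>E carrier R" "w \<in> {..<n} \<rightarrow>\<^sub>E carrier R" for v w
  proof -
    have "(\<lambda>i. v i \<otimes> w i) \<in> J \<rightarrow> carrier R" "v j \<otimes> w j \<in> carrier R"
      using that j(1) by (auto simp: J_def)
    then show ?thesis
      using finsum_insert[OF J(1,4), of "\<lambda>i. v i \<otimes> w i"] J(3) by (simp add: dot_prod_def)
  qed
  have "inj_on (\<lambda>v. restrict v J) H"
  proof (rule inj_onI)
    fix v w assume v: "v \<in> H" and w: "w \<in> H" and eq: "restrict v J = restrict w J"
    have vw: "v i = w i" if "i \<in> J" for i using eq that by (metis restrict_apply')
    have vC: "v \<in> {..<n} \<rightarrow>\<^sub>E carrier R" and wC: "w \<in> {..<n} \<rightarrow>\<^sub>E carrier R"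
      using v w by (auto simp: H_def)
    \<comment> \<open>\<open>v\<close> and \<open>w\<close> agree on \<open>J\<close>, so these
      coordinates contribute the same amount to both dot products: \<open>Y\<close> against
      \<open>y\<close> and \<open>Z\<close> against \<open>z\<close>.\<close>
    have S: "(\<Oplus>i\<in>J. v i \<otimes> x i) = (\<Oplus>i\<in>J. w i \<otimes> x i)" if "x \<in> {..<n} \<rightarrow>\<^sub>E carrier R" for x
      using vw that wC by (intro finsum_cong') (auto simp: J_def)
    define Y where "Y = (\<Oplus>i\<in>J. w i \<otimes> y i)"
    define Z where "Z = (\<Oplus>i\<in>J. w i \<otimes> z i)"
    have "(\<Oplus>i\<in>J. w i \<otimes> x i) \<in> carrier R" if "x \<in> {..<n} \<rightarrow>\<^sub>E carrier R" for x
      using that wC by (intro finsum_closed) (auto simp: J_def)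
    then have cl: "Y \<in> carrier R" "Z \<in> carrier R" "v j \<in> carrier R" "w j \<in> carrier R"
      "y j \<in> carrier R" "z j \<in> carrier R"
      unfolding Y_def Z_def using PiE_mem[OF vC] PiE_mem[OF wC] PiE_mem[OF y] PiE_mem[OF z] y z j(1)
      by simp_all
    have ev: "v j \<otimes> y j \<oplus> Y = v j \<otimes> z j \<oplus> Z"
      using v split[OF vC y] split[OF vC z] S[OF y] S[OF z] by (simp add: H_def Y_def Z_def)
    have ew: "w j \<otimes> y j \<oplus> Y = w j \<otimes> z j \<oplus> Z"
      using w split[OF wC y] split[OF wC z] by (simp add: H_def Y_def Z_def)
    \<comment> \<open>Inserting \<open>Y\<close> and \<open>Z\<close> rewrites the product in terms
      of the two collision equations, so it vanishes; as \<open>y j\<close> and \<open>z j\<close>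
      differ, \<open>v j = w j\<close> follows.\<close>
    have expand: "(v j \<ominus> w j) \<otimes> (y j \<ominus> z j) =
        ((v j \<otimes> y j \<oplus> Y) \<ominus> (v j \<otimes> z j \<oplus> Z)) \<ominus> ((w j \<otimes> y j \<oplus> Y) \<ominus> (w j \<otimes> z j \<oplus> Z))"
      using cl by algebra
    have "(v j \<ominus> w j) \<otimes> (y j \<ominus> z j) = \<zero>"
      unfolding expand ev ew using cl by algebra
    then have "v j \<ominus> w j = \<zero> \<or> y j \<ominus> z j = \<zero>"
      using cl by (intro integral) auto
    then have "v j = w j" using cl j by auto
    then have "v i = w i" if "i \<in> {..<n}" for i
      using that vw by (cases "i = j") (auto simp: J_def)
    then show "v = w" using vC wC by (intro PiE_ext) auto
  qed
  moreover have "(\<lambda>v. restrict v J) ` H \<subseteq> J \<rightarrow>\<^sub>E carrier R"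
    by (intro image_subsetI) (simp add: H_def J_def PiE_iff)
  ultimately have "card H \<le> card (J \<rightarrow>\<^sub>E carrier R)"
    using J fin by (intro card_inj_on_le) (auto simp: finite_PiE)
  then have "card H * card (carrier R) \<le> card (carrier R) ^ (n - 1) * card (carrier R)"
    using J by (simp add: card_funcsetE)
  also have "\<dots> = card (carrier R) ^ n"
    using j by (metis gr_implies_not0 power_minus_mult not_gr0)
  finally show ?thesis by (simp add: H_def)
qed

section \<open>Hashing points by their dot products with a tuple of vectors\<close>

text \<open>The matrix with rows \<open>m i\<close> applied to \<open>x\<close>. Values are
  extensional so that they lie in a set of exactly \<open>q ^ k\<close> elements, \<open>q\<close>
  being the order of the field.\<close>

definition tuple_map :: "nat \<Rightarrow> nat \<Rightarrow> (nat \<Rightarrow> nat \<Rightarrow> 'a) \<Rightarrow> (nat \<Rightarrow> 'a) \<Rightarrow> nat \<Rightarrow> 'a" where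
  "tuple_map n k m x = restrict (\<lambda>i. dot_prod R n (m i) x) {..<k}"

text \<open>The condition separates over the entries of \<open>m\<close>: colliding tuples are
  exactly those with all entries in \<open>H\<close>, so the bound for one vector is raised to the
  power \<open>k\<close>.\<close>

lemma card_tuple_map_collisions:
  assumes fin: "finite (carrier R)"
    and y: "y \<in> {..<n} \<rightarrow>\<^sub>E carrier R" and z: "z \<in> {..<n} \<rightarrow>\<^sub>E carrier R" and yz: "y \<noteq> z"
  shows "card {m \<in> {..<k} \<rightarrow>\<^sub>E ({..<n} \<rightarrow>\<^sub>E carrier R). tuple_map n k m y = tuple_map n k m z}
      * card ({..<k} \<rightarrow>\<^sub>E carrier R) \<le> card ({..<k} \<rightarrow>\<^sub>E ({..<n} \<rightarrow>\<^sub>E carrier R))"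
proof -
  define H where "H = {v \<in> {..<n} \<rightarrow>\<^sub>E carrier R. dot_prod R n v y = dot_prod R n v z}"
  have "tuple_map n k m y = tuple_map n k m z \<longleftrightarrow> (\<forall>i<k. dot_prod R n (m i) y = dot_prod R n (m i) z)"
    for m
    by (auto simp: tuple_map_def restrict_def fun_eq_iff)
  then have "{m \<in> {..<k} \<rightarrow>\<^sub>E ({..<n} \<rightarrow>\<^sub>E carrier R). tuple_map n k m y = tuple_map n k m z} =
      {..<k} \<rightarrow>\<^sub>E H"
    by (simp add: set_eq_iff H_def PiE_iff[of _ "{..<k}"] Ball_def) blast
  moreover have "(card H * card (carrier R)) ^ k \<le> (card (carrier R) ^ n) ^ k"
    using card_dot_prod_collisions[OF assms] by (intro power_mono) (auto simp: H_def)
  ultimately show ?thesis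
    by (simp add: card_funcsetE power_mult_distrib)
qed

text \<open>Two points of one coset differ by a vector orthogonal to \<open>V\<close>, hence to
  every entry of \<open>m\<close>.\<close>

lemma tuple_map_eq_if_coset_eq:
  assumes V: "V \<subseteq> {..<n} \<rightarrow>\<^sub>E carrier R" and m: "m \<in> {..<k} \<rightarrow>\<^sub>E V"
    and x: "x \<in> {..<n} \<rightarrow>\<^sub>E carrier R" and y: "y \<in> {..<n} \<rightarrow>\<^sub>E carrier R"
    and mem: "x \<in> y <+\<^bsub>coord_space R n\<^esub> orth_compl R n V"
  shows "tuple_map n k m x = tuple_map n k m y"
proof -
  obtain w where w: "w \<in> orth_compl R n V" "x = y \<oplus>\<^bsub>coord_space R n\<^esub> w"
    using mem by (auto simp: a_l_coset_def')
  show ?thesis unfolding tuple_map_def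
  proof (rule restrict_ext)
    fix i assume "i \<in> {..<k}"
    then have mi: "m i \<in> V" using m by auto
    have "dot_prod R n (m i) x = dot_prod R n (m i) y \<oplus> dot_prod R n (m i) w"
      unfolding w(2) using w(1) mi V y by (intro dot_prod_add_right) (auto simp: orth_compl_def)
    then show "dot_prod R n (m i) x = dot_prod R n (m i) y"
      using w(1) mi V y by (auto simp: orth_compl_def subset_eq)
  qed
qed

lemma card_tuple_map_image_le_projection:
  assumes fin: "finite (carrier R)"
    and V: "V \<subseteq> {..<n} \<rightarrow>\<^sub>E carrier R" and m: "m \<in> {..<k} \<rightarrow>\<^sub>E V"
    and E: "E \<subseteq> {..<n} \<rightarrow>\<^sub>E carrier R"
  shows "card (tuple_map n k m ` E) \<le> card (projection R n V E)"
proof -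
  define c where "c x = x <+\<^bsub>coord_space R n\<^esub> orth_compl R n V" for x
  have finC: "finite ({..<n} \<rightarrow>\<^sub>E carrier R)" using fin by (simp add: finite_PiE)
  have self: "x \<in> c x" if "x \<in> {..<n} \<rightarrow>\<^sub>E carrier R" for x
  proof -
    have "x = x \<oplus>\<^bsub>coord_space R n\<^esub> \<zero>\<^bsub>coord_space R n\<^esub>"
      using that by (auto simp: fun_eq_iff PiE_iff extensional_def)
    then show ?thesis
      using zero_in_orth_compl[OF V] unfolding c_def a_l_coset_def' by blast
  qed
  have proj: "projection R n V E \<subseteq> c ` ({..<n} \<rightarrow>\<^sub>E carrier R)"
    by (auto simp: projection_def c_def)
  have "c ` E \<subseteq> projection R n V E"
  proof
    fix X assume "X \<in> c ` E"
    then obtain x where x: "x \<in> E" "X = c x" by auto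
    then have "x \<in> {..<n} \<rightarrow>\<^sub>E carrier R" using E by auto
    with x self show "X \<in> projection R n V E"
      unfolding projection_def c_def[symmetric] coord_space_simps by blast
  qed
  \<comment> \<open>Infinite sets have \<open>card\<close> 0, so monotonicity of \<open>card\<close>
    requires finiteness here.\<close>
  moreover have "finite (projection R n V E)"
    using proj finC finite_surj by blast
  ultimately have le: "card (c ` E) \<le> card (projection R n V E)"
    by (intro card_mono)
  \<comment> \<open>The factorisation through cosets: \<open>SOME\<close> picks a representative in
    \<open>E\<close>, and its choice is immaterial because the tuple map is constant on
    cosets.\<close>
  have eq: "tuple_map n k m ` E = (\<lambda>X. tuple_map n k m (SOME x. x \<in> E \<and> c x = X)) ` c ` E"
  proof -
    have "tuple_map n k m x = tuple_map n k m (SOME x'. x' \<in> E \<and> c x' = c x)" if x: "x \<in> E" for x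
    proof -
      let ?y = "SOME x'. x' \<in> E \<and> c x' = c x"
      have y: "?y \<in> E \<and> c ?y = c x" using someI[of "\<lambda>x'. x' \<in> E \<and> c x' = c x" x] x by simp
      have xC: "x \<in> {..<n} \<rightarrow>\<^sub>E carrier R" and yC: "?y \<in> {..<n} \<rightarrow>\<^sub>E carrier R"
        using E x y by auto
      have "x \<in> c ?y" using self[OF xC] y by simp
      then show ?thesis
        unfolding c_def[of ?y] by (rule tuple_map_eq_if_coset_eq[OF V m xC yC])
    qed
    then show ?thesis unfolding image_image by (rule image_cong[OF refl])
  qed
  have "finite E" using finC E by (rule finite_subset[rotated])
  then show ?thesis
    unfolding eq by (intro order_trans[OF card_image_le le]) simp
qed

section \<open>Counting subspaces through their spanning tuples\<close>

text \<open>Since the span recovers \<open>V\<close>, these sets are disjoint for different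
  \<open>V\<close>; this turns a bound on tuples into a bound on subspaces.\<close>

definition generating_tuples :: "nat \<Rightarrow> nat \<Rightarrow> (nat \<Rightarrow> 'a) set \<Rightarrow> (nat \<Rightarrow> nat \<Rightarrow> 'a) set" where
  "generating_tuples n k V = {m \<in> {..<k} \<rightarrow>\<^sub>E V. module.span R (coord_space R n) (m ` {..<k}) = V}"

lemma grassmannian_subset: "V \<in> grassmannian R k n \<Longrightarrow> V \<subseteq> {..<n} \<rightarrow>\<^sub>E carrier R"
  using submodule.subset[of R V "coord_space R n"]
  by (simp add: grassmannian_def subspace_def)

lemma card_generating_tuples:
  assumes fin: "finite (carrier R)" and V: "V \<in> grassmannian R k n"
  shows "generating_tuples n k V \<noteq> {}"
    and "card (carrier R) ^ (k * k) \<le>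
      card (generating_tuples n k V) + k * card (carrier R) ^ (k * k - 1)"
proof -
  interpret C: vectorspace R "coord_space R n" by (rule vectorspace_coord_space)
  have sub: "subspace R V (coord_space R n)" using V by (simp add: grassmannian_def)
  interpret W: vectorspace R "(coord_space R n)\<lparr>carrier := V\<rparr>"
    by (rule C.subspace_is_vs[OF sub])
  have dim: "W.dim = k" using V by (simp add: grassmannian_def)
  have finV: "finite V"
    using grassmannian_subset[OF V] fin finite_subset[of V "{..<n} \<rightarrow>\<^sub>E carrier R"]
    by (simp add: finite_PiE)
  \<comment> \<open>The span inside \<open>V\<close> agrees with the ambient one, so the counts for
    an abstract vector space apply to \<open>W\<close>.\<close>
  have "module.span R (coord_space R n) (m ` {..<k}) = W.span (m ` {..<k})"
    if "m \<in> {..<k} \<rightarrow>\<^sub>E V" for m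
    using that sub by (intro C.span_li_not_depend(1)[symmetric]) auto
  then have eq: "generating_tuples n k V =
      {m \<in> {..<W.dim} \<rightarrow>\<^sub>E carrier ((coord_space R n)\<lparr>carrier := V\<rparr>).
        W.span (m ` {..<W.dim}) = carrier ((coord_space R n)\<lparr>carrier := V\<rparr>)}"
    by (auto simp: generating_tuples_def dim)
  show "generating_tuples n k V \<noteq> {}"
    unfolding eq using W.exists_generating_tuple finV by auto
  show "card (carrier R) ^ (k * k) \<le>
      card (generating_tuples n k V) + k * card (carrier R) ^ (k * k - 1)"
    unfolding eq using W.card_generating_tuples_ge[OF fin] finV by (simp add: dim)
qed

text \<open>The disjoint sets of generating tuples of bad subspaces all consist of bad tuples, which
  the hashing bound counts. \<open>\<gamma>\<close> stays free because large and small fields use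
  different lower bounds.\<close>

lemma card_small_projections_le:
  fixes u \<gamma> :: real
  assumes fin: "finite (carrier R)"
    and E: "E \<subseteq> {..<n} \<rightarrow>\<^sub>E carrier R" "E \<noteq> {}"
    and u: "0 < u" "u \<le> real (card (carrier R)) ^ k / 2"
    and \<gamma>: "\<And>V. V \<in> grassmannian R k n \<Longrightarrow> \<gamma> \<le> card (generating_tuples n k V)"
  shows "card {V \<in> grassmannian R k n. real (card (projection R n V E)) \<le> u} * \<gamma> * card E
    \<le> 2 * u * real (card (carrier R)) ^ (n * k)"
proof -
  define \<Theta> where "\<Theta> = {V \<in> grassmannian R k n. real (card (projection R n V E)) \<le> u}"
  define M where "M = {..<k} \<rightarrow>\<^sub>E ({..<n} \<rightarrow>\<^sub>E carrier R)"
  define B where "B = {m \<in> M. real (card (tuple_map n k m ` E)) \<le> u}"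
  have finC: "finite ({..<n} \<rightarrow>\<^sub>E carrier R)" using fin by (simp add: finite_PiE)
  have finM: "finite M" using finC by (simp add: M_def finite_PiE)
  have finE: "finite E" using E finC finite_subset by blast
  have "\<Theta> \<subseteq> Pow ({..<n} \<rightarrow>\<^sub>E carrier R)"
    unfolding \<Theta>_def by (rule subsetI, rule PowI, rule grassmannian_subset[of _ k]) simp
  then have fin\<Theta>: "finite \<Theta>"
    using finC by (simp add: finite_subset)
  have sub: "generating_tuples n k V \<subseteq> B" if "V \<in> \<Theta>" for V
  proof
    fix m assume m: "m \<in> generating_tuples n k V"
    have V: "V \<subseteq> {..<n} \<rightarrow>\<^sub>E carrier R"
      using that by (intro grassmannian_subset[of V k]) (simp add: \<Theta>_def)
    have mV: "m \<in> {..<k} \<rightarrow>\<^sub>E V" using m by (simp add: generating_tuples_def)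
    have "m \<in> M"
      using mV V unfolding M_def by (auto simp: PiE_iff)
    moreover have "real (card (tuple_map n k m ` E)) \<le> u"
      using card_tuple_map_image_le_projection[OF fin V mV E(1)] that
      by (auto simp: \<Theta>_def)
    ultimately show "m \<in> B" by (simp add: B_def)
  qed
  have finB: "finite B" using finM by (simp add: B_def)
  have "card \<Theta> * \<gamma> = (\<Sum>V\<in>\<Theta>. \<gamma>)" by simp
  also have "\<dots> \<le> (\<Sum>V\<in>\<Theta>. real (card (generating_tuples n k V)))"
    using \<gamma> by (intro sum_mono) (auto simp: \<Theta>_def)
  also have "\<dots> = card (\<Union>V\<in>\<Theta>. generating_tuples n k V)"
    using fin\<Theta> finite_subset[OF sub finB]
    by (subst card_UN_disjoint) (auto simp: generating_tuples_def)
  also have "\<dots> \<le> card B"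
    using sub finB by (intro of_nat_mono card_mono) auto
  finally have 1: "card \<Theta> * \<gamma> \<le> card B" .
  have "real (card B) * card E \<le> 2 * u * card M"
    unfolding B_def
  proof (rule universal_family_few_values_le[where T = "{..<k} \<rightarrow>\<^sub>E carrier R", OF finM finE E(2)])
    show "finite ({..<k} \<rightarrow>\<^sub>E carrier R)" using fin by (simp add: finite_PiE)
    show "tuple_map n k m x \<in> {..<k} \<rightarrow>\<^sub>E carrier R" if "m \<in> M" "x \<in> E" for m x
      using that E by (auto simp: tuple_map_def M_def intro!: dot_prod_closed)
    show "card {m \<in> M. tuple_map n k m x = tuple_map n k m y} * card ({..<k} \<rightarrow>\<^sub>E carrier R)
        \<le> card M" if "x \<in> E" "y \<in> E" "x \<noteq> y" for x y
      unfolding M_def using that E by (intro card_tuple_map_collisions[OF fin]) auto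
    show "u \<le> real (card ({..<k} \<rightarrow>\<^sub>E carrier R)) / 2" using u by (simp add: card_funcsetE)
  qed (use u in auto)
  also have "real (card M) = real (card (carrier R)) ^ (n * k)"
    by (simp add: M_def card_funcsetE power_mult)
  finally have "real (card B) * card E \<le> 2 * u * real (card (carrier R)) ^ (n * k)" .
  then show ?thesis
    using mult_right_mono[OF 1, of "real (card E)"] by (simp add: \<Theta>_def)
qed

end

section \<open>Choice of the error term and the two ranges of \<open>q\<close>\<close>

theorem corollary10p1:
  fixes n k :: nat
  assumes "n \<ge> 1" and "k \<le> n"
  shows "\<exists>\<eta> :: nat \<Rightarrow> real. \<eta> \<in> o(\<lambda>_. 1) \<and>
    (\<forall>q (R :: 'a ring) E (u :: real).
       primepow q \<and> field R \<and> card (carrier R) = q \<and>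
       E \<subseteq> carrier (coord_space R n) \<and> E \<noteq> {} \<and>
       0 < u \<and> u \<le> real q ^ k / 2 \<longrightarrow>
       real (card {V \<in> grassmannian R k n. real (card (projection R n V E)) \<le> u})
         \<le> (4 + \<eta> q) * u * real q ^ (k * (n - k)) * inverse (real (card E)))"
proof -
  \<comment> \<open>Below \<open>2 * k\<close>, one generating tuple per subspace costs the whole
    factor \<open>q ^ (k * k)\<close>, and the 2 comes from the hashing bound. Only finitely many
    \<open>q\<close> are affected.\<close>
  define \<eta> :: "nat \<Rightarrow> real" where "\<eta> q = (if 2 * k \<le> q then 0 else 2 * real q ^ (k * k))" for q
  have "eventually (\<lambda>q. \<eta> q = 0) sequentially"
    using eventually_ge_at_top[of "2 * k"] by eventually_elim (simp add: \<eta>_def)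
  then have small: "\<eta> \<in> o(\<lambda>_. 1)"
    by (subst landau_o.small.in_cong) auto
  have bound: "real (card {V \<in> grassmannian R k n. real (card (projection R n V E)) \<le> u})
         \<le> (4 + \<eta> q) * u * real q ^ (k * (n - k)) * inverse (real (card E))"
    if q: "primepow q" and "field R" and card: "card (carrier R) = q"
      and E: "E \<subseteq> carrier (coord_space R n)" "E \<noteq> {}"
      and u: "0 < u" "u \<le> real q ^ k / 2" for q and R :: "'a ring" and E and u :: real
  proof -
    interpret field R by fact
    define t where "t = real (card {V \<in> grassmannian R k n. real (card (projection R n V E)) \<le> u})"
    define Q where "Q = real q ^ (k * (n - k))"
    have q0: "q > 0" using q by (rule primepow_gt_0_nat)
    have fin: "finite (carrier R)" using card q0 by (simp add: card_ge_0_finite)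
    have E': "E \<subseteq> {..<n} \<rightarrow>\<^sub>E carrier R" using E by simp
    have "finite E" using E' fin finite_subset by (metis finite_PiE finite_lessThan)
    then have e: "0 < real (card E)" using E by (simp add: card_gt_0_iff)
    \<comment> \<open>As \<open>k \<le> n\<close>, the exponent \<open>n * k\<close> splits into
      \<open>k * (n - k)\<close> and \<open>k * k\<close>; the second part is what a lower bound
      \<open>\<gamma>\<close> near \<open>q ^ (k * k)\<close> cancels.\<close>
    have main: "t * \<gamma> * card E \<le> 2 * u * (Q * real q ^ (k * k))"
      if "\<And>V. V \<in> grassmannian R k n \<Longrightarrow> \<gamma> \<le> card (generating_tuples n k V)" for \<gamma> :: real
    proof -
      have "n * k = k * (n - k) + k * k"
        using assms(2) by (simp add: diff_mult_distrib2 mult.commute)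
      then show ?thesis
        using card_small_projections_le[OF fin E' E(2) u(1) _ that] u card
        by (simp add: t_def Q_def power_add)
    qed
    have "t * card E \<le> (4 + \<eta> q) * u * Q"
    proof (cases "2 * k \<le> q")
      case True
      \<comment> \<open>Taking half of all tuples for \<open>\<gamma>\<close> doubles the hashing
        constant 2, which yields the 4.\<close>
      have "t * (real q ^ (k * k) / 2) * card E \<le> 2 * u * (Q * real q ^ (k * k))"
      proof (rule main)
        fix V assume "V \<in> grassmannian R k n"
        then have ge: "q ^ (k * k) \<le> card (generating_tuples n k V) + k * q ^ (k * k - 1)"
          using card_generating_tuples(2)[OF fin] card by simp
        have "2 * (k * q ^ (k * k - 1)) \<le> q ^ (k * k)"
        \<comment> \<open>For \<open>k = 0\<close> the exponent \<open>k * k - 1\<close> truncates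
          to 0, but the factor \<open>k\<close> makes the left side vanish.\<close>
        proof (cases "k = 0")
          case False
          then have "q ^ (k * k) = q * q ^ (k * k - 1)"
            by (metis mult_is_0 power_eq_if)
          then show ?thesis using mult_right_mono[OF True, of "q ^ (k * k - 1)"] by (simp add: mult_ac)
        qed simp
        then have "q ^ (k * k) \<le> 2 * card (generating_tuples n k V)" using ge by linarith
        then have "real (q ^ (k * k)) \<le> real (2 * card (generating_tuples n k V))"
          by (rule of_nat_mono)
        then show "real q ^ (k * k) / 2 \<le> card (generating_tuples n k V)" by simp
      qed
      then have "real q ^ (k * k) * (t * card E) \<le> real q ^ (k * k) * (4 * u * Q)"
        by (simp add: mult_ac)
      then show ?thesis using True q0 by (simp add: \<eta>_def)
    next
      case False
      have "t * 1 * card E \<le> 2 * u * (Q * real q ^ (k * k))"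
      proof (rule main)
        fix V assume V: "V \<in> grassmannian R k n"
        have "finite (generating_tuples n k V)"
          using grassmannian_subset[OF V] fin finite_subset[of V "{..<n} \<rightarrow>\<^sub>E carrier R"]
          by (simp add: generating_tuples_def finite_PiE)
        then show "1 \<le> real (card (generating_tuples n k V))"
          using card_generating_tuples(1)[OF fin V] by (simp add: Suc_le_eq card_gt_0_iff)
      qed
      also have "\<dots> = \<eta> q * u * Q" using False by (simp add: \<eta>_def)
      also have "\<dots> \<le> (4 + \<eta> q) * u * Q"
        using u by (intro mult_right_mono) (auto simp: Q_def)
      finally show ?thesis by simp
    qed
    then show ?thesis
      using e by (simp add: t_def Q_def field_simps)
  qed
  show ?thesis
    using small bound by (intro exI[of _ \<eta>]) blast
qed

end
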